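(* Let $n\ge 2$ be even. There exist two distinct input graphs $\mathcal{G}_1$ and $\mathcal{G}_2$, each with $n$ offline and $n$ online vertices on the same offline vertex set and each with a fixed arrival order of its online vertices, such that the first $n/2$ online arrivals of $\mathcal{G}_1$ and of $\mathcal{G}_2$ have exactly the same types in the same order (so that, given the same advice, whatever it is, no online algorithm can distinguish the two within the first $n/2$ online arrivals). Consequently, in the adversarial arrival model, for every advice set $\mathcal{S}$ and every perfect-advice map into $\mathcal{S}$, no (possibly randomized) learning-augmented online algorithm for instances with $n$ offline and $n$ online vertices is both $1$-consistent and $b$-robust for some $b>1/2$.
   Context: Online unweighted bipartite matching: an instance consists of a bipartite graph $\mathcal{G}=(U\cup V,E)$ with $|U|=|V|=n$, together with an arrival order of the online vertices $V$. The offline vertices $U$ are known in advance. Online vertices arrive one at a time. When $v\in V$ arrives, its type, i.e. its neighborhood $\{u\in U: \{u,v\}\in E\}$, is revealed, and the algorithm must irrevocably either leave $v$ unmatched or match it to a currently unmatched neighbor. Let $n^*\le n$ denote the maximum size of a matching in $\mathcal{G}$. In the adversarial arrival model both the graph and the arrival order are chosen by an adversary. A learning-augmented algorithm receives, before any arrivals, an advice element $a\in\mathcal{S}$, where $\mathcal{S}$ is an arbitrary set; its decisions may depend on $a$, on the types revealed so far, and on internal randomness. A perfect-advice map is an arbitrary function assigning to every instance $I$ an element $a^*(I)\in\mathcal{S}$, regarded as the correct advice for $I$. The algorithm is $c$-consistent if on every instance $I$, when given $a^*(I)$, its expected number of matches is at least $c\cdot n^*$. It is $b$-robust if on every instance $I$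 and for every advice $a\in\mathcal{S}$, its expected number of matches is at least $b\cdot n^*$. *)

theory Defs
  imports "HOL-Probability.Probability"
begin

text \<open>
  An instance on offline vertices \<open>U\<close> and online vertices \<open>V\<close>.  An edge is a pair (offline vertex,
  online vertex), so the two sides are kept apart even if \<open>U\<close> and \<open>V\<close> overlap as sets.
\<close>

record ('u, 'v) online_instance =
  edges :: "('u \<times> 'v) set"
  arrival :: "'v list"

definition instance_on :: "'u set \<Rightarrow> 'v set \<Rightarrow> ('u, 'v) online_instance \<Rightarrow> bool" where
  "instance_on U V I \<longleftrightarrow>
     edges I \<subseteq> U \<times> V \<and> distinct (arrival I) \<and> set (arrival I) = V"

definition vertex_type :: "('u \<times> 'v) set \<Rightarrow> 'v \<Rightarrow> 'u set" where
  "vertex_type E v = {u. (u, v) \<in> E}"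

definition arrival_types :: "('u, 'v) online_instance \<Rightarrow> 'u set list" where
  "arrival_types I = map (vertex_type (edges I)) (arrival I)"

definition is_matching :: "('u \<times> 'v) set \<Rightarrow> ('u \<times> 'v) set \<Rightarrow> bool" where
  "is_matching E M \<longleftrightarrow> M \<subseteq> E \<and>
     (\<forall>e\<in>M. \<forall>f\<in>M. e \<noteq> f \<longrightarrow> fst e \<noteq> fst f \<and> snd e \<noteq> snd f)"

definition max_matching_size :: "('u \<times> 'v) set \<Rightarrow> nat" where
  "max_matching_size E = Max {card M | M. is_matching E M}"

text \<open>
  A policy is what an online algorithm does once its advice and its random seed are fixed: it maps
  the nonempty list of types revealed so far, the current one last, to the offline vertex to
  which the current arrival is matched (\<open>None\<close>: it stays unmatched).  The earlier decisions
  are determined by the seed and the earlier types, so they need not be passed as arguments.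
\<close>

type_synonym 'u policy = "'u set list \<Rightarrow> 'u option"

definition decisions :: "'u policy \<Rightarrow> 'u set list \<Rightarrow> 'u option list" where
  "decisions p ts = map (\<lambda>i. p (take (Suc i) ts)) [0..<length ts]"

definition legal_policy :: "'u set \<Rightarrow> nat \<Rightarrow> 'u policy \<Rightarrow> bool" where
  "legal_policy U n p \<longleftrightarrow>
     (\<forall>ts. ts \<in> lists (Pow U) \<and> length ts = n \<longrightarrow>
        (\<forall>i<n. \<forall>u. decisions p ts ! i = Some u \<longrightarrow>
           u \<in> ts ! i \<and> (\<forall>j<i. decisions p ts ! j \<noteq> Some u)))"

definition produced_matching :: "'u policy \<Rightarrow> ('u, 'v) online_instance \<Rightarrow> ('u \<times> 'v) set" where
  "produced_matching p I =
     {(u, arrival I ! i) | u i. i < length (arrival I) \<and> decisions p (arrival_types I) ! i = Some u}"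

text \<open>
  A randomized algorithm with advice in \<open>S\<close>: \<open>A a \<omega>\<close> is the policy followed
  under advice \<open>a\<close> when the internal randomness, distributed according to the probability
  space \<open>R\<close>, takes the value \<open>\<omega>\<close>.
\<close>

definition learning_augmented_algorithm ::
  "'u set \<Rightarrow> nat \<Rightarrow> 's set \<Rightarrow> 'w measure \<Rightarrow> ('s \<Rightarrow> 'w \<Rightarrow> 'u policy) \<Rightarrow> bool" where
  "learning_augmented_algorithm U n S R A \<longleftrightarrow>
     prob_space R \<and>
     (\<forall>a\<in>S. \<forall>\<omega>\<in>space R. legal_policy U n (A a \<omega>)) \<and>
     (\<forall>a\<in>S. \<forall>h\<in>lists (Pow U). 0 < length h \<and> length h \<le> n \<longrightarrow>
        (\<lambda>\<omega>. A a \<omega> h) \<in> measurable R (count_space UNIV))"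

definition expected_matches ::
  "'w measure \<Rightarrow> ('w \<Rightarrow> 'u policy) \<Rightarrow> ('u, 'v) online_instance \<Rightarrow> real" where
  "expected_matches R P I = (\<integral>\<omega>. real (card (produced_matching (P \<omega>) I)) \<partial>R)"

definition perfect_advice_map ::
  "'u set \<Rightarrow> 'v set \<Rightarrow> 's set \<Rightarrow> (('u, 'v) online_instance \<Rightarrow> 's) \<Rightarrow> bool" where
  "perfect_advice_map U V S adv \<longleftrightarrow> (\<forall>I. instance_on U V I \<longrightarrow> adv I \<in> S)"

definition consistent ::
  "real \<Rightarrow> 'u set \<Rightarrow> 'v set \<Rightarrow> (('u, 'v) online_instance \<Rightarrow> 's) \<Rightarrow>
     'w measure \<Rightarrow> ('s \<Rightarrow> 'w \<Rightarrow> 'u policy) \<Rightarrow> bool" where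
  "consistent c U V adv R A \<longleftrightarrow>
     (\<forall>I. instance_on U V I \<longrightarrow>
        expected_matches R (A (adv I)) I \<ge> c * real (max_matching_size (edges I)))"

definition robust ::
  "real \<Rightarrow> 'u set \<Rightarrow> 'v set \<Rightarrow> 's set \<Rightarrow>
     'w measure \<Rightarrow> ('s \<Rightarrow> 'w \<Rightarrow> 'u policy) \<Rightarrow> bool" where
  "robust b U V S R A \<longleftrightarrow>
     (\<forall>I. instance_on U V I \<longrightarrow>
        (\<forall>a\<in>S. expected_matches R (A a) I \<ge> b * real (max_matching_size (edges I))))"

end

theory Submission
  imports Defs
begin

text \<open>
  Split the offline vertices into halves \<open>A\<close> and \<open>B\<close>.  The first \<open>n/2\<close> arrivals see all of \<open>U\<close>; the
  remaining ones see only \<open>A\<close> in the first graph and only \<open>B\<close> in the second.  Both graphs have a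
  perfect matching.  For a fixed seed let \<open>F\<close> be the set of offline vertices used in the first half,
  which is the same in both graphs.  The two matchings use offline vertices in \<open>F \<union> A\<close> and \<open>F \<union> B\<close>,
  so their sizes add up to at most \<open>|U| + |F| \<le> 3n/2\<close>.  Taking expectations under the advice
  correct for the first graph, consistency forces \<open>n\<close> matches there, which leaves at most \<open>n/2\<close>
  matches in the second.
\<close>

lemma length_decisions [simp]: "length (decisions p ts) = length ts"
  by (simp add: decisions_def)

text \<open>Each decision reads only the types up to its own arrival. This is where the online
  restriction enters: equal type prefixes force equal decision prefixes.\<close>

lemma take_decisions: "take k (decisions p ts) = decisions p (take k ts)"
  by (auto simp: decisions_def take_map min_def intro!: nth_equalityI)

lemma length_arrival_types [simp]: "length (arrival_types I) = length (arrival I)"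
  by (simp add: arrival_types_def)

lemma legal_policyD:
  assumes "legal_policy U n p" "ts \<in> lists (Pow U)" "length ts = n"
    and "i < n" "decisions p ts ! i = Some u"
  shows "u \<in> ts ! i" "j < i \<Longrightarrow> decisions p ts ! j \<noteq> Some u"
  using assms unfolding legal_policy_def by blast+

text \<open>Legality forbids using an offline vertex twice, so \<open>fst\<close> is injective on
  the produced matching, and counting matches reduces to counting offline vertices.\<close>

lemma card_produced_matching_le:
  assumes legal: "legal_policy U n p"
    and types: "arrival_types I \<in> lists (Pow U)" "length (arrival I) = n"
    and W: "finite W" "\<And>i u. i < n \<Longrightarrow> decisions p (arrival_types I) ! i = Some u \<Longrightarrow> u \<in> W"
  shows "card (produced_matching p I) \<le> card W"
proof (rule card_inj_on_le[where f = fst])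
  show "inj_on fst (produced_matching p I)"
  proof (rule inj_onI)
    fix e f assume "e \<in> produced_matching p I" "f \<in> produced_matching p I" "fst e = fst f"
    then obtain u i j where *: "e = (u, arrival I ! i)" "f = (u, arrival I ! j)" "i < n" "j < n"
      "decisions p (arrival_types I) ! i = Some u" "decisions p (arrival_types I) ! j = Some u"
      using types unfolding produced_matching_def by auto
    then have "\<not> i < j" "\<not> j < i"
      using legal_policyD(2)[OF legal] types by (metis length_arrival_types)+
    then show "e = f" using * by simp
  qed
  show "fst ` produced_matching p I \<subseteq> W"
    using W types unfolding produced_matching_def by auto
qed (rule W)

lemma card_le_max_matching_size:
  assumes "finite E" "is_matching E M"
  shows "card M \<le> max_matching_size E"
proof -
  have "{M. is_matching E M} \<subseteq> Pow E" by (auto simp: is_matching_def)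
  then have "finite {M. is_matching E M}" using assms(1) by (meson finite_Pow_iff finite_subset)
  then have "finite {card M | M. is_matching E M}" by simp
  then show ?thesis unfolding max_matching_size_def using assms(2) by (auto intro: Max_ge)
qed

text \<open>The two hard instances share \<open>U\<close>, \<open>xs\<close> and \<open>ys\<close>
  and differ only in \<open>A\<close>.\<close>

definition two_phase_instance ::
  "'u set \<Rightarrow> 'u set \<Rightarrow> 'v list \<Rightarrow> 'v list \<Rightarrow> ('u, 'v) online_instance" where
  "two_phase_instance U A xs ys =
     \<lparr>edges = U \<times> set xs \<union> A \<times> set ys, arrival = xs @ ys\<rparr>"

lemma instance_on_two_phase:
  assumes "A \<subseteq> U" "distinct (xs @ ys)"
  shows "instance_on U (set (xs @ ys)) (two_phase_instance U A xs ys)"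
  using assms by (auto simp: instance_on_def two_phase_instance_def)

lemma arrival_types_two_phase:
  assumes "distinct (xs @ ys)"
  shows "arrival_types (two_phase_instance U A xs ys) =
           replicate (length xs) U @ replicate (length ys) A"
proof -
  have "map (vertex_type (U \<times> set xs \<union> A \<times> set ys)) xs = map (\<lambda>_. U) xs"
    "map (vertex_type (U \<times> set xs \<union> A \<times> set ys)) ys = map (\<lambda>_. A) ys"
    using assms by (auto simp: vertex_type_def)
  then show ?thesis
    by (simp add: arrival_types_def two_phase_instance_def map_replicate_const)
qed

text \<open>The late arrivals \<open>ys\<close> take exactly \<open>A\<close>; the early ones
  \<open>xs\<close>, adjacent to everything, take the rest. A lower bound suffices, since
  consistency and robustness scale with the optimum.\<close>

lemma max_matching_size_two_phase:
  assumes "finite U" "A \<subseteq> U" "distinct (xs @ ys)"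
    and cards: "card A = length ys" "card (U - A) = length xs"
  shows "length (xs @ ys) \<le> max_matching_size (edges (two_phase_instance U A xs ys))"
proof -
  have fin: "finite A" "finite (U - A)"
    using assms(1,2) finite_subset by auto
  obtain f where f: "bij_betw f (set xs) (U - A)"
    using finite_same_card_bij[of "set xs" "U - A"] fin assms(3) cards by (auto simp: distinct_card)
  obtain g where g: "bij_betw g (set ys) A"
    using finite_same_card_bij[of "set ys" A] fin assms(3) cards by (auto simp: distinct_card)
  define h where "h v = (if v \<in> set xs then f v else g v)" for v
  define M where "M = (\<lambda>v. (h v, v)) ` set (xs @ ys)"
  have img: "h v \<in> U - A" if "v \<in> set xs" for v
    using f that by (auto simp: h_def bij_betw_def)
  have img': "h v \<in> A" if "v \<in> set ys" for v
    using g that assms(3) by (auto simp: h_def bij_betw_def)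
  have "inj_on h (set xs)"
    using f by (auto simp: h_def bij_betw_def inj_on_def)
  moreover have "inj_on h (set ys)"
    using g assms(3) by (auto simp: h_def bij_betw_def inj_on_def)
  \<comment> \<open>The set differences are the shape that \<open>inj_on_Un\<close> asks
    for.\<close>
  moreover have "h ` (set xs - set ys) \<inter> h ` (set ys - set xs) = {}"
    using img img' by fastforce
  ultimately have inj: "inj_on h (set (xs @ ys))" by (simp add: inj_on_Un)
  have "is_matching (U \<times> set xs \<union> A \<times> set ys) M"
    unfolding is_matching_def M_def using img img' inj by (auto dest: inj_onD)
  then have "card M \<le> max_matching_size (U \<times> set xs \<union> A \<times> set ys)"
    using assms(1) fin by (intro card_le_max_matching_size) auto
  moreover have "card M = length (xs @ ys)"
    unfolding M_def using assms(3)
    by (subst card_image) (auto intro: inj_onI simp: distinct_card card_Un_disjoint)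
  ultimately show ?thesis by (simp add: two_phase_instance_def)
qed

text \<open>Since \<open>A\<close> and \<open>B\<close> are complementary, an offline vertex can be
  used in both runs only if the common first phase uses it. Inclusion-exclusion then gives the
  bound.\<close>

lemma card_produced_two_phase_add_le:
  assumes "finite U" "A \<union> B = U" "A \<inter> B = {}" "distinct (xs @ ys)"
    and legal: "legal_policy U (length (xs @ ys)) p"
  shows "card (produced_matching p (two_phase_instance U A xs ys)) +
         card (produced_matching p (two_phase_instance U B xs ys)) \<le> card U + length xs"
proof -
  let ?m = "length xs"
  \<comment> \<open>\<open>F\<close> comes from the bare prefix \<open>replicate ?m U\<close>,
    without \<open>A\<close> or \<open>B\<close>, so one set serves both instances.\<close>
  define F where "F = {u. Some u \<in> set (decisions p (replicate ?m U))}"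
  have first: "u \<in> F"
    if "i < ?m" "decisions p (arrival_types (two_phase_instance U C xs ys)) ! i = Some u" for i u C
  proof -
    have "take ?m (decisions p (arrival_types (two_phase_instance U C xs ys))) =
        decisions p (replicate ?m U)"
      using assms(4) by (simp add: take_decisions arrival_types_two_phase)
    then have "decisions p (replicate ?m U) ! i = Some u"
      using that by (metis nth_take)
    then show ?thesis
      using that(1) unfolding F_def
      by (metis length_decisions length_replicate mem_Collect_eq nth_mem)
  qed
  have F: "Some ` F \<subseteq> set (decisions p (replicate ?m U))" by (auto simp: F_def)
  then have finF: "finite F" by (meson List.finite_set finite_imageD finite_subset inj_Some)
  have "card F = card (Some ` F)" by (simp add: card_image)
  also have "\<dots> \<le> ?m"
    using card_mono[OF _ F] card_length[of "decisions p (replicate ?m U)"] by simp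
  finally have cardF: "card F \<le> ?m" .
  \<comment> \<open>\<open>legal_policy\<close> speaks only of type lists of full length, so
    \<open>F\<close> is not directly known to lie in \<open>U\<close>; intersecting with
    \<open>U\<close> avoids the question.\<close>
  have bound: "card (produced_matching p (two_phase_instance U C xs ys)) \<le> card (F \<inter> U \<union> C)"
    if "C \<subseteq> U" for C
  proof (rule card_produced_matching_le[OF legal])
    let ?I = "two_phase_instance U C xs ys"
    show types: "arrival_types ?I \<in> lists (Pow U)"
      using that assms(4) by (auto simp: arrival_types_two_phase)
    show len: "length (arrival ?I) = length (xs @ ys)"
      by (simp add: two_phase_instance_def)
    show "finite (F \<inter> U \<union> C)" using that assms(1) finite_subset by blast
    fix i u assume i: "i < length (xs @ ys)" and u: "decisions p (arrival_types ?I) ! i = Some u"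
    have mem: "u \<in> arrival_types ?I ! i"
      using legal_policyD(1)[OF legal types _ i u] len by simp
    show "u \<in> F \<inter> U \<union> C"
    proof (cases "i < ?m")
      case True
      then show ?thesis using first[OF True u] mem assms(4)
        by (simp add: arrival_types_two_phase nth_append)
    next
      case False
      then show ?thesis using mem i assms(4)
        by (simp add: arrival_types_two_phase nth_append)
    qed
  qed
  have fin: "finite A" "finite B" using assms(1,2) by auto
  have "card (F \<inter> U \<union> A) + card (F \<inter> U \<union> B) = card U + card (F \<inter> U)"
  proof -
    have "(F \<inter> U \<union> A) \<union> (F \<inter> U \<union> B) = U" "(F \<inter> U \<union> A) \<inter> (F \<inter> U \<union> B) = F \<inter> U"
      using assms(2,3) by auto
    then show ?thesis using card_Un_Int[of "F \<inter> U \<union> A" "F \<inter> U \<union> B"] fin finF by simp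
  qed
  moreover have "card (F \<inter> U) \<le> ?m" using cardF card_mono[OF finF, of "F \<inter> U"] by simp
  ultimately show ?thesis using bound[of A] bound[of B] assms(2) by auto
qed

text \<open>Carries the bound for a fixed seed over to expectations. In the application consistency
  and robustness supply the positivity.\<close>

lemma expected_matches_add_le:
  assumes "prob_space R"
    and pos: "expected_matches R P I > 0" "expected_matches R P J > 0"
    and le: "\<And>\<omega>. \<omega> \<in> space R \<Longrightarrow>
       card (produced_matching (P \<omega>) I) + card (produced_matching (P \<omega>) J) \<le> k"
  shows "expected_matches R P I + expected_matches R P J \<le> real k"
proof -
  interpret prob_space R by fact
  let ?f = "\<lambda>I \<omega>. real (card (produced_matching (P \<omega>) I))"
  \<comment> \<open>A non-integrable function has integral \<open>0\<close>, so positivity yields integrability.\<close>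
  have int: "integrable R (?f I)" "integrable R (?f J)"
    using pos not_integrable_integral_eq unfolding expected_matches_def by fastforce+
  then have "expected_matches R P I + expected_matches R P J = (\<integral>\<omega>. ?f I \<omega> + ?f J \<omega> \<partial>R)"
    unfolding expected_matches_def by simp
  also have "\<dots> \<le> real k"
  proof (rule integral_le_const)
    show "integrable R (\<lambda>\<omega>. ?f I \<omega> + ?f J \<omega>)" using int by simp
    show "AE \<omega> in R. ?f I \<omega> + ?f J \<omega> \<le> real k"
      using le by (intro AE_I2) (metis of_nat_add of_nat_le_iff)
  qed
  finally show ?thesis .
qed

theorem theorem3p1:
  fixes n :: nat and U :: "'u set" and V :: "'v set"
  assumes "n \<ge> 2" and "even n"
    and "finite U" and "card U = n" and "finite V" and "card V = n"
  shows "(\<exists>I1 I2 :: ('u, 'v) online_instance.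
            instance_on U V I1 \<and> instance_on U V I2 \<and> edges I1 \<noteq> edges I2 \<and>
            take (n div 2) (arrival_types I1) = take (n div 2) (arrival_types I2) \<and>
            (\<forall>(S :: 's set) (R :: 'w measure) (A :: 's \<Rightarrow> 'w \<Rightarrow> 'u policy).
               learning_augmented_algorithm U n S R A \<longrightarrow>
               (\<forall>a\<in>S. \<forall>\<omega>\<in>space R.
                  take (n div 2) (decisions (A a \<omega>) (arrival_types I1)) =
                  take (n div 2) (decisions (A a \<omega>) (arrival_types I2))))) \<and>
         (\<forall>(S :: 's set) (adv :: ('u, 'v) online_instance \<Rightarrow> 's).
            perfect_advice_map U V S adv \<longrightarrow>
            \<not> (\<exists>(R :: 'w measure) (A :: 's \<Rightarrow> 'w \<Rightarrow> 'u policy).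
                  learning_augmented_algorithm U n S R A \<and>
                  consistent 1 U V adv R A \<and>
                  (\<exists>b > 1/2. robust b U V S R A)))"
proof -
  define m where "m = n div 2"
  have n: "n = m + m" "m > 0" using assms(1,2) unfolding m_def by auto
  obtain vs where vs: "set vs = V" "distinct vs"
    using finite_distinct_list[OF assms(5)] by blast
  define xs ys where "xs = take m vs" and "ys = drop m vs"
  have "length vs = n" using vs assms(6) distinct_card by fastforce
  then have len: "length xs = m" "length ys = m" using n by (auto simp: xs_def ys_def)
  have app: "set (xs @ ys) = V" and dist: "distinct (xs @ ys)"
    using vs by (simp_all add: xs_def ys_def del: set_append distinct_append)
  obtain A where A: "A \<subseteq> U" "card A = m"
    using obtain_subset_with_card_n[of m U] assms(4) n by auto
  define B where "B = U - A"
  have cB: "card B = m"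
    using A assms(3,4) n by (simp add: B_def card_Diff_subset finite_subset)
  have UB: "U - B = A" "B \<subseteq> U" "A \<union> B = U" "A \<inter> B = {}" using A by (auto simp: B_def)
  define I1 where "I1 = two_phase_instance U A xs ys"
  define I2 where "I2 = two_phase_instance U B xs ys"
  have inst: "instance_on U V I1" "instance_on U V I2"
    using instance_on_two_phase[OF A(1) dist] instance_on_two_phase[OF UB(2) dist] app
    by (simp_all add: I1_def I2_def)
  have types: "take m (arrival_types I1) = take m (arrival_types I2)"
    using dist len by (simp add: I1_def I2_def arrival_types_two_phase)
  have "edges I1 \<noteq> edges I2"
  proof
    assume eq: "edges I1 = edges I2"
    \<comment> \<open>As \<open>m > 0\<close>, some late arrival \<open>y\<close> and some
      \<open>a\<close> in \<open>A\<close> exist; they are adjacent in \<open>I1\<close> but not in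
      \<open>I2\<close>.\<close>
    obtain a y where a: "a \<in> A" and y: "y \<in> set ys"
      using A(2) len n(2) by (metis card.empty ex_in_conv less_irrefl list.size(3) set_empty)
    then have "(a, y) \<in> edges I1" by (simp add: I1_def two_phase_instance_def)
    then have "(a, y) \<in> edges I2" using eq by simp
    then show False
      using a y UB(4) dist by (auto simp: I2_def two_phase_instance_def)
  qed
  moreover have "take (n div 2) (decisions p (arrival_types I1)) =
      take (n div 2) (decisions p (arrival_types I2))" for p :: "'u policy"
    using types by (simp add: take_decisions m_def)
  ultimately have indist: "\<exists>I1 I2 :: ('u, 'v) online_instance.
      instance_on U V I1 \<and> instance_on U V I2 \<and> edges I1 \<noteq> edges I2 \<and>
      take (n div 2) (arrival_types I1) = take (n div 2) (arrival_types I2) \<and>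
      (\<forall>(S :: 's set) (R :: 'w measure) (A :: 's \<Rightarrow> 'w \<Rightarrow> 'u policy).
         learning_augmented_algorithm U n S R A \<longrightarrow>
         (\<forall>a\<in>S. \<forall>\<omega>\<in>space R.
            take (n div 2) (decisions (A a \<omega>) (arrival_types I1)) =
            take (n div 2) (decisions (A a \<omega>) (arrival_types I2))))"
    using inst types unfolding m_def by blast
  have opt: "n \<le> max_matching_size (edges I1)" "n \<le> max_matching_size (edges I2)"
    using max_matching_size_two_phase[OF assms(3) A(1) dist]
      max_matching_size_two_phase[OF assms(3) UB(2) dist] A cB UB(1) len n
    by (simp_all add: I1_def I2_def B_def)
  have False
    if adv: "perfect_advice_map U V S adv" and alg: "learning_augmented_algorithm U n S R Alg"
      and cons: "consistent 1 U V adv R Alg" and b: "b > 1/2" and rob: "robust b U V S R Alg"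
    for S :: "'s set" and adv :: "('u, 'v) online_instance \<Rightarrow> 's" and R :: "'w measure"
      and Alg :: "'s \<Rightarrow> 'w \<Rightarrow> 'u policy" and b :: real
  proof -
    \<comment> \<open>The advice correct for \<open>I1\<close> is used on both instances:
      consistency controls the run on \<open>I1\<close>, and robustness covers \<open>I2\<close>
      whatever the advice.\<close>
    define a where "a = adv I1"
    have a: "a \<in> S" using adv inst by (simp add: perfect_advice_map_def a_def)
    have E1: "expected_matches R (Alg a) I1 \<ge> real n"
      using cons inst(1) opt(1) unfolding consistent_def a_def by fastforce
    have "b * real n \<le> b * real (max_matching_size (edges I2))"
      using opt(2) b by (intro mult_left_mono) auto
    also have "\<dots> \<le> expected_matches R (Alg a) I2"
      using rob inst(2) a unfolding robust_def by blast
    finally have E2: "expected_matches R (Alg a) I2 \<ge> b * real n" .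
    \<comment> \<open>Half of \<open>n\<close> is exactly \<open>m\<close> by evenness, so
      \<open>b > 1/2\<close> gives strictly more than \<open>m\<close> matches on \<open>I2\<close>.
      Together with \<open>n\<close> on \<open>I1\<close> this exceeds the joint bound
      \<open>n + m\<close>.\<close>
    have "1/2 * real n < b * real n" using b n by (intro mult_strict_right_mono) auto
    then have half: "expected_matches R (Alg a) I2 > real m"
      using E2 n(1) by linarith
    have "expected_matches R (Alg a) I1 + expected_matches R (Alg a) I2 \<le> real (n + m)"
    proof (rule expected_matches_add_le)
      show "prob_space R" using alg by (simp add: learning_augmented_algorithm_def)
      show "expected_matches R (Alg a) I1 > 0" using E1 n by simp
      show "expected_matches R (Alg a) I2 > 0" using half by simp
      fix \<omega> assume "\<omega> \<in> space R"
      then have "legal_policy U (length (xs @ ys)) (Alg a \<omega>)"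
        using alg a len n by (simp add: learning_augmented_algorithm_def)
      from card_produced_two_phase_add_le[OF assms(3) UB(3,4) dist this]
      show "card (produced_matching (Alg a \<omega>) I1) + card (produced_matching (Alg a \<omega>) I2) \<le> n + m"
        using assms(4) len by (simp add: I1_def I2_def)
    qed
    then show False using E1 half by simp
  qed
  with indist show ?thesis by blast
qed

end
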